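(* For any integers $m\geq1$ and $k\geq0$ there exist rational numbers $b_0,\dots,b_k$ such that for all $y>0$, \[ \bar S_{2(m+k)-1,2k+1}(y)=\sum_{j=0}^k b_j\frac{d^{2j}}{dy^{2j}}\Big(\bar S_{2(m+k-j)-1,1}(y)\Big). \]
   Context: For integers $p$ and $m\ge1$ and real $y>0$, $\bar S_{p,m}(y)=\sum_{n=1}^\infty\frac{(-1)^{n-1}n^p}{\sinh^m(ny)}$. *)

theory Defs
  imports "HOL-Analysis.Analysis"
begin

text \<open>The summation index is shifted by one: the \<open>n\<close>-th summand below is the
  \<open>(n + 1)\<close>-st summand of the alternating series starting at \<open>1\<close>, whence the sign
  \<open>(- 1) ^ n\<close>. Only arguments \<open>y > 0\<close> and exponents \<open>m \<ge> 1\<close> are meaningful.\<close>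

definition S_bar :: "int \<Rightarrow> nat \<Rightarrow> real \<Rightarrow> real" where
  "S_bar p m y = (\<Sum>n. (- 1) ^ n * real (Suc n) powi p / sinh (real (Suc n) * y) ^ m)"

end

theory Submission
  imports Defs "HOL-Real_Asymp.Real_Asymp"
begin

text \<open>On \<open>x > 0\<close> the function \<open>u = 1 / sinh\<close> satisfies \<open>u'\<^sup>2 = u\<^sup>2 + u\<^sup>4\<close>, hence
  \<open>(u\<^sup>r)'' = r\<^sup>2 u\<^sup>r + r (r + 1) u\<^sup>r\<^sup>+\<^sup>2\<close>. All series converge locally uniformly in \<open>y > 0\<close>, so they
  can be differentiated termwise, each derivative producing an extra factor \<open>n\<close>. Thus
  \<open>S\<^sub>p\<^sub>,\<^sub>r'' = r\<^sup>2 S\<^sub>p\<^sub>+\<^sub>2\<^sub>,\<^sub>r + r (r + 1) S\<^sub>p\<^sub>+\<^sub>2\<^sub>,\<^sub>r\<^sub>+\<^sub>2\<close>, which, solved for the last term, expresses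
  exponent \<open>r + 2\<close> through exponent \<open>r\<close>; the claim follows by induction from \<open>r = 1\<close>.\<close>

section \<open>Termwise differentiation\<close>

text \<open>The constant may depend on \<open>a\<close>, since powers of \<open>1 / sinh\<close>
  blow up at 0. At \<open>x = N * y\<close> the fixed rate gives geometric decay in \<open>N\<close>
  for \<open>y \<ge> a\<close>.\<close>

definition exp_decaying :: "(real \<Rightarrow> real) \<Rightarrow> bool" where
  "exp_decaying f \<longleftrightarrow> (\<forall>a>0. \<exists>C. \<forall>x\<ge>a. \<bar>f x\<bar> \<le> C * exp (- x))"

text \<open>A general \<open>f\<close> is allowed because the first derivative of a hyperbolic
  series has terms in \<open>cosh x / sinh x ^ (r + 1)\<close> and so leaves the family
  \<open>S_bar\<close>.\<close>

definition alt_series :: "int \<Rightarrow> (real \<Rightarrow> real) \<Rightarrow> real \<Rightarrow> real" where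
  "alt_series p f y = (\<Sum>n. (- 1) ^ n * real (Suc n) powi p * f (real (Suc n) * y))"

lemma exp_decaying_add:
  assumes "exp_decaying f" "exp_decaying g"
  shows "exp_decaying (\<lambda>x. f x + g x)"
  unfolding exp_decaying_def
proof (intro allI impI)
  fix a :: real assume "a > 0"
  then obtain C D where "\<forall>x\<ge>a. \<bar>f x\<bar> \<le> C * exp (- x)" "\<forall>x\<ge>a. \<bar>g x\<bar> \<le> D * exp (- x)"
    using assms unfolding exp_decaying_def by blast
  then have "\<forall>x\<ge>a. \<bar>f x + g x\<bar> \<le> (C + D) * exp (- x)"
    by (smt (verit, best) distrib_right)
  then show "\<exists>C. \<forall>x\<ge>a. \<bar>f x + g x\<bar> \<le> C * exp (- x)" by blast
qed

lemma exp_decaying_cmult: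
  assumes "exp_decaying f"
  shows "exp_decaying (\<lambda>x. c * f x)"
  unfolding exp_decaying_def
proof (intro allI impI)
  fix a :: real assume "a > 0"
  then obtain C where C: "\<forall>x\<ge>a. \<bar>f x\<bar> \<le> C * exp (- x)"
    using assms unfolding exp_decaying_def by blast
  have "\<bar>c * f x\<bar> \<le> (\<bar>c\<bar> * C) * exp (- x)" if "x \<ge> a" for x
    using mult_left_mono[OF C[rule_format, OF that] abs_ge_zero[of c]] by (simp add: abs_mult mult.assoc)
  then show "\<exists>C. \<forall>x\<ge>a. \<bar>c * f x\<bar> \<le> C * exp (- x)" by blast
qed

lemma summable_powi_exp:
  fixes a :: real
  assumes "a > 0"
  shows "summable (\<lambda>n. real (Suc n) powi p * exp (- (real (Suc n) * a)))"
proof (rule summable_comparison_test_bigo)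
  show "summable (\<lambda>n. norm (1 / real n ^ 2))"
    using inverse_power_summable[of 2, where ?'a = real] by (simp add: field_simps)
  \<comment> \<open>Passing from \<open>powi\<close> to \<open>powr\<close> lets
    \<open>real_asymp\<close> treat the symbolic exponent \<open>p\<close>.\<close>
  have "(\<lambda>n. real (Suc n) powr real_of_int p * exp (- (real (Suc n) * a))) \<in> O(\<lambda>n. 1 / real n ^ 2)"
    using assms by real_asymp
  then show "(\<lambda>n. real (Suc n) powi p * exp (- (real (Suc n) * a))) \<in> O(\<lambda>n. 1 / real n ^ 2)"
    by (simp add: powr_real_of_int' del: of_nat_Suc)
qed

text \<open>This is the majorant for the Weierstrass test. Since \<open>N \<ge> 1\<close>, all
  points \<open>N * y\<close> stay in the range \<open>\<ge> a\<close> where a single constant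
  works.\<close>

lemma exp_decaying_dominated:
  assumes "exp_decaying f" "a > 0"
  shows "\<exists>M. summable M \<and>
    (\<forall>n. \<forall>y\<ge>a. norm ((- 1) ^ n * real (Suc n) powi p * f (real (Suc n) * y)) \<le> M n)"
proof -
  obtain C where C: "\<And>x. x \<ge> a \<Longrightarrow> \<bar>f x\<bar> \<le> C * exp (- x)"
    using assms unfolding exp_decaying_def by blast
  have "0 \<le> C * exp (- a)" using C[of a] by linarith
  then have "C \<ge> 0" by (simp add: zero_le_mult_iff)
  define M where "M n = C * (real (Suc n) powi p * exp (- (real (Suc n) * a)))" for n
  show ?thesis
  proof (intro exI[of _ M] conjI allI impI)
    show "summable M"
      unfolding M_def by (intro summable_mult summable_powi_exp assms)
    fix n y assume y: "(y::real) \<ge> a"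
    define N where "N = real (Suc n)"
    have "N \<ge> 1" by (simp add: N_def)
    have "N * a \<le> N * y" using y \<open>N \<ge> 1\<close> by (intro mult_left_mono) auto
    moreover have "a \<le> N * a" using \<open>N \<ge> 1\<close> \<open>a > 0\<close> by simp
    ultimately have "\<bar>f (N * y)\<bar> \<le> C * exp (- (N * y))" by (intro C) linarith
    also have "\<dots> \<le> C * exp (- (N * a))"
      using \<open>N * a \<le> N * y\<close> \<open>C \<ge> 0\<close> by (intro mult_left_mono) auto
    finally have "N powi p * \<bar>f (N * y)\<bar> \<le> N powi p * (C * exp (- (N * a)))"
      using \<open>N \<ge> 1\<close> by (intro mult_left_mono) auto
    then show "norm ((- 1) ^ n * real (Suc n) powi p * f (real (Suc n) * y)) \<le> M n"
      using \<open>N \<ge> 1\<close> unfolding M_def N_def[symmetric] by (simp add: abs_mult power_abs mult_ac)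
  qed
qed

lemma summable_alt_series:
  assumes "exp_decaying f" "y > 0"
  shows "summable (\<lambda>n. (- 1) ^ n * real (Suc n) powi p * f (real (Suc n) * y))"
proof -
  from exp_decaying_dominated[OF assms, where p = p] obtain M where M: "summable M \<and>
    (\<forall>n. \<forall>x\<ge>y. norm ((- 1) ^ n * real (Suc n) powi p * f (real (Suc n) * x)) \<le> M n)" ..
  show ?thesis
    by (rule summable_comparison_test'[of M 0]) (use M in \<open>simp_all del: norm_mult of_nat_Suc\<close>)
qed

lemma alt_series_add:
  assumes "exp_decaying f" "exp_decaying g" "y > 0"
  shows "alt_series p (\<lambda>x. f x + g x) y = alt_series p f y + alt_series p g y"
  using suminf_add[OF summable_alt_series[OF assms(1,3), of p] summable_alt_series[OF assms(2,3), of p]]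
  unfolding alt_series_def by (simp add: distrib_left)

lemma alt_series_cmult:
  assumes "exp_decaying f" "y > 0"
  shows "alt_series p (\<lambda>x. c * f x) y = c * alt_series p f y"
  using suminf_mult[OF summable_alt_series[OF assms, of p], of c]
  unfolding alt_series_def by (simp add: mult_ac)

text \<open>The chain rule on \<open>f (N * y)\<close> yields a factor \<open>N\<close>, which
  raises the power of \<open>N\<close> from \<open>p\<close> to \<open>p + 1\<close>.\<close>

lemma alt_series_has_derivative:
  assumes deriv: "\<And>x. x > 0 \<Longrightarrow> (f has_real_derivative f' x) (at x)"
    and decay: "exp_decaying f" "exp_decaying f'"
    and "y > 0"
  shows "(alt_series p f has_real_derivative alt_series (p + 1) f' y) (at y)"
  unfolding alt_series_def[abs_def]
\<comment> \<open>The half-line beyond \<open>y / 2\<close> is an open neighbourhood of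
  \<open>y\<close> that stays away from 0, so one majorant serves all of it.\<close>
proof (rule has_field_derivative_series'(2)[where S = "{y/2<..}" and x0 = y])
  have y2: "y / 2 > 0" using \<open>y > 0\<close> by simp
  show "((\<lambda>y. (- 1) ^ n * real (Suc n) powi p * f (real (Suc n) * y)) has_real_derivative
      (- 1) ^ n * real (Suc n) powi (p + 1) * f' (real (Suc n) * x)) (at x within {y / 2<..})"
    if "x \<in> {y / 2<..}" for n x
  proof -
    define N where "N = real (Suc n)"
    have "N > 0" by (simp add: N_def)
    have "x > 0" using that y2 by simp
    then have "(f has_real_derivative f' (N * x)) (at (N * x))"
      using \<open>N > 0\<close> by (intro deriv) simp
    then have "((\<lambda>y. f (N * y)) has_real_derivative f' (N * x) * N) (at x)"
      by (rule DERIV_chain2) (auto intro!: derivative_eq_intros)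
    from DERIV_cmult[OF this, of "(- 1) ^ n * N powi p"]
    have "((\<lambda>y. (- 1) ^ n * N powi p * f (N * y)) has_real_derivative
        (- 1) ^ n * N powi (p + 1) * f' (N * x)) (at x)"
      using \<open>N > 0\<close> by (simp add: power_int_add_1 mult_ac)
    then show ?thesis
      unfolding N_def by (rule has_field_derivative_at_within)
  qed
  from exp_decaying_dominated[OF decay(2) y2, where p = "p + 1"] obtain M where M: "summable M \<and>
    (\<forall>n. \<forall>x\<ge>y / 2. norm ((- 1) ^ n * real (Suc n) powi (p + 1) * f' (real (Suc n) * x)) \<le> M n)" ..
  show "uniformly_convergent_on {y / 2<..}
      (\<lambda>n x. \<Sum>i<n. (- 1) ^ i * real (Suc i) powi (p + 1) * f' (real (Suc i) * x))"
    by (rule Weierstrass_m_test'[of _ _ M]) (use M in \<open>simp_all del: norm_mult of_nat_Suc\<close>)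
  show "summable (\<lambda>n. (- 1) ^ n * real (Suc n) powi p * f (real (Suc n) * y))"
    by (rule summable_alt_series[OF decay(1) \<open>y > 0\<close>])
qed (use \<open>y > 0\<close> in \<open>auto simp: interior_open\<close>)

section \<open>The second derivative of the hyperbolic series\<close>

text \<open>For \<open>x \<ge> a\<close>, \<open>sinh x\<close> is at least a constant times
  \<open>exp x\<close> and \<open>cosh x \<le> exp x\<close>, so the quotient is of order
  \<open>exp (- r * x)\<close>. The case \<open>s = 0\<close> covers the powers of
  \<open>1 / sinh\<close>, and \<open>s = 1\<close> their derivatives.\<close>

lemma exp_decaying_cosh_sinh:
  assumes "r \<ge> 1"
  shows "exp_decaying (\<lambda>x. cosh x ^ s / sinh x ^ (r + s))"
  unfolding exp_decaying_def
proof (intro allI impI)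
  fix a :: real assume "a > 0"
  \<comment> \<open>This is the value at \<open>x = a\<close> of
    \<open>sinh x / exp x = (1 - exp (- 2 * x)) / 2\<close>, which increases with
    \<open>x\<close>.\<close>
  define c where "c = (1 - exp (- 2 * a)) / 2"
  have "c > 0" using \<open>a > 0\<close> by (simp add: c_def)
  have "\<bar>cosh x ^ s / sinh x ^ (r + s)\<bar> \<le> (1 / c ^ (r + s)) * exp (- x)" if "x \<ge> a" for x
  proof -
    have "x > 0" using that \<open>a > 0\<close> by simp
    have "c * exp x \<le> (1 - exp (- 2 * x)) / 2 * exp x"
      using that by (intro mult_right_mono) (auto simp: c_def)
    also have "\<dots> = sinh x"
      by (simp add: sinh_field_def field_simps flip: exp_add)
    finally have sinh: "c * exp x \<le> sinh x" .
    have cosh: "cosh x \<le> exp x"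
      using \<open>x > 0\<close> by (simp add: cosh_field_def)
    have "cosh x ^ s / sinh x ^ (r + s) \<le> exp x ^ s / (c * exp x) ^ (r + s)"
      using cosh sinh \<open>c > 0\<close> \<open>x > 0\<close> by (intro frac_le power_mono) auto
    also have "\<dots> = 1 / c ^ (r + s) * (1 / exp x ^ r)"
      using \<open>c > 0\<close> by (simp add: power_mult_distrib power_add)
    also have "\<dots> \<le> 1 / c ^ (r + s) * (1 / exp x ^ 1)"
      using \<open>c > 0\<close> \<open>x > 0\<close> assms
      by (intro mult_left_mono divide_left_mono power_increasing) auto
    finally show ?thesis
      using \<open>x > 0\<close> by (simp add: exp_minus field_simps)
  qed
  then show "\<exists>C. \<forall>x\<ge>a. \<bar>cosh x ^ s / sinh x ^ (r + s)\<bar> \<le> C * exp (- x)" by blast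
qed

lemma exp_decaying_csch_power: "r \<ge> 1 \<Longrightarrow> exp_decaying (\<lambda>x. 1 / sinh x ^ r)"
  using exp_decaying_cosh_sinh[of r 0] by simp

lemma S_bar_eq_alt_series: "S_bar p r = alt_series p (\<lambda>x. 1 / sinh x ^ r)"
  by (simp add: S_bar_def alt_series_def fun_eq_iff)

text \<open>Two termwise differentiations raise \<open>p\<close> by 2. The intermediate
  \<open>T\<close> stays abstract, as only the second derivative is again a combination of
  \<open>S_bar\<close> series.\<close>

lemma S_bar_deriv2:
  assumes "r \<ge> 1"
  obtains T where
    "\<And>y. y > 0 \<Longrightarrow> (S_bar p r has_real_derivative T y) (at y)"
    "\<And>y. y > 0 \<Longrightarrow> (T has_real_derivative
      real r ^ 2 * S_bar (p + 2) r y + real (r * (r + 1)) * S_bar (p + 2) (r + 2) y) (at y)"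
proof
  define g h where "g x = cosh x / sinh x ^ (r + 1)"
    and "h x = real r ^ 2 * (1 / sinh x ^ r) + real (r * (r + 1)) * (1 / sinh x ^ (r + 2))"
    for x :: real
  define f where "f x = - real r * g x" for x
  have decay_f: "exp_decaying f"
    using exp_decaying_cosh_sinh[OF assms, of 1] unfolding f_def g_def
    by (intro exp_decaying_cmult) simp
  have decay_h: "exp_decaying h"
    unfolding h_def using assms
    by (intro exp_decaying_add exp_decaying_cmult exp_decaying_csch_power) auto
  fix y :: real assume "y > 0"
  have "((\<lambda>x. 1 / sinh x ^ r) has_real_derivative f x) (at x)" if "x > 0" for x :: real
  proof -
    \<comment> \<open>Splitting off one factor, possible as \<open>r \<ge> 1\<close>, lets
      \<open>sinh x ^ (r - 1)\<close> cancel in the quotient rule.\<close>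
    have "sinh x ^ r = sinh x * sinh x ^ (r - 1)"
      using assms by (simp flip: power_Suc)
    moreover have "((\<lambda>x. 1 / sinh x ^ r) has_real_derivative
        - (real r * sinh x ^ (r - 1) * cosh x) / (sinh x ^ r * sinh x ^ r)) (at x)"
      using that by (auto intro!: derivative_eq_intros simp: mult_ac simp del: power_Suc)
    ultimately show ?thesis
      using that by (simp add: f_def g_def)
  qed
  then show "(S_bar p r has_real_derivative alt_series (p + 1) f y) (at y)"
    unfolding S_bar_eq_alt_series
    using decay_f assms \<open>y > 0\<close> by (intro alt_series_has_derivative exp_decaying_csch_power)
  have "(f has_real_derivative h x) (at x)" if "x > 0" for x
  proof -
    define s where "s = sinh x"
    have "s > 0" using that by (simp add: s_def)
    have cosh2: "cosh x * cosh x = s * s + 1"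
      using cosh_square_eq[of x] by (simp add: s_def power2_eq_square)
    have "(f has_real_derivative - real r * ((s * s ^ (r + 1)
        - cosh x * (real (r + 1) * s ^ r * cosh x)) / (s ^ (r + 1) * s ^ (r + 1)))) (at x)"
      unfolding f_def[abs_def] g_def s_def using that
      by (intro DERIV_cmult) (auto intro!: derivative_eq_intros simp: mult_ac simp del: power_Suc)
    also have "cosh x * (real (r + 1) * s ^ r * cosh x) = real (r + 1) * s ^ r * (s * s + 1)"
      by (simp add: mult.assoc mult.left_commute flip: cosh2)
    also have "- real r * ((s * s ^ (r + 1) - real (r + 1) * s ^ r * (s * s + 1))
        / (s ^ (r + 1) * s ^ (r + 1))) = h x"
    proof -
      \<comment> \<open>With \<open>P\<close> in place of \<open>s ^ r\<close>, what remains is an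
        identity of rational functions in \<open>s\<close> and \<open>P\<close>.\<close>
      have "- real r * ((s * (s * P) - real (r + 1) * P * (s * s + 1)) / (s * P * (s * P)))
          = real r ^ 2 * (1 / P) + real (r * (r + 1)) * (1 / (s * (s * P)))" if "P > 0" for P
        using \<open>s > 0\<close> that by (simp add: divide_simps power2_eq_square) (simp add: algebra_simps)
      from this[of "s ^ r"] show ?thesis
        using \<open>s > 0\<close> by (simp add: h_def flip: s_def)
    qed
    finally show ?thesis .
  qed
  then have "(alt_series (p + 1) f has_real_derivative alt_series (p + 1 + 1) h y) (at y)"
    using decay_f decay_h \<open>y > 0\<close> by (intro alt_series_has_derivative)
  also have "alt_series (p + 1 + 1) h y =
      real r ^ 2 * S_bar (p + 2) r y + real (r * (r + 1)) * S_bar (p + 2) (r + 2) y"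
  proof -
    have "exp_decaying (\<lambda>x. 1 / sinh x ^ r)" "exp_decaying (\<lambda>x. 1 / sinh x ^ (r + 2))"
      by (rule exp_decaying_csch_power, use assms in linarith)+
    moreover have "p + 1 + 1 = p + 2" by simp
    ultimately show ?thesis
      unfolding h_def[abs_def] S_bar_eq_alt_series using \<open>y > 0\<close>
      by (simp only: alt_series_add alt_series_cmult exp_decaying_cmult)
  qed
  finally show "(alt_series (p + 1) f has_real_derivative
      real r ^ 2 * S_bar (p + 2) r y + real (r * (r + 1)) * S_bar (p + 2) (r + 2) y) (at y)" .
qed

lemma S_bar_second_deriv:
  assumes "r \<ge> 1" "y > 0"
  shows "(deriv ^^ 2) (S_bar p r) y =
    real r ^ 2 * S_bar (p + 2) r y + real (r * (r + 1)) * S_bar (p + 2) (r + 2) y"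
proof -
  obtain T where T: "\<And>y. y > 0 \<Longrightarrow> (S_bar p r has_real_derivative T y) (at y)"
    "\<And>y. y > 0 \<Longrightarrow> (T has_real_derivative
      real r ^ 2 * S_bar (p + 2) r y + real (r * (r + 1)) * S_bar (p + 2) (r + 2) y) (at y)"
    using S_bar_deriv2[OF assms(1)] by blast
  \<comment> \<open>Differentiating \<open>deriv (S_bar p r)\<close> at \<open>y\<close> requires
    its agreement with \<open>T\<close> on a whole neighbourhood of \<open>y\<close>.\<close>
  have "eventually (\<lambda>y. y \<in> {0<..}) (nhds y)"
    using assms by (intro eventually_nhds_in_open) auto
  then have "eventually (\<lambda>y. deriv (S_bar p r) y = T y) (nhds y)"
    by eventually_elim (auto intro!: DERIV_imp_deriv T)
  then show ?thesis
    using T(2)[OF assms(2)] by (simp add: numeral_2_eq_2 deriv_cong_ev DERIV_imp_deriv)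
qed

section \<open>Higher derivatives\<close>

lemma higher_deriv_cong_open:
  fixes f g :: "real \<Rightarrow> real"
  assumes "open U" "x \<in> U" "\<And>y. y \<in> U \<Longrightarrow> f y = g y"
  shows "(deriv ^^ n) f x = (deriv ^^ n) g x"
proof (rule higher_deriv_cong_ev)
  show "eventually (\<lambda>y. f y = g y) (nhds x)"
    using eventually_nhds_in_open[OF assms(1,2)] by eventually_elim (rule assms(3))
qed simp

text \<open>\<open>deriv\<close> is a total function whose linearity relies on differentiability.
  Since each induction step differentiates the previous identity, that identity must hold throughout
  \<open>U\<close>.\<close>

lemma higher_deriv_linear_combination:
  fixes f g :: "real \<Rightarrow> real"
  assumes "open U"
    and "\<And>i x. i < n \<Longrightarrow> x \<in> U \<Longrightarrow> (deriv ^^ i) f field_differentiable at x"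
    and "\<And>i x. i < n \<Longrightarrow> x \<in> U \<Longrightarrow> (deriv ^^ i) g field_differentiable at x"
    and "x \<in> U"
  shows "(deriv ^^ n) (\<lambda>y. a * f y + b * g y) x = a * (deriv ^^ n) f x + b * (deriv ^^ n) g x"
  using assms
proof (induction n arbitrary: x)
  case (Suc n)
  have "(deriv ^^ Suc n) (\<lambda>y. a * f y + b * g y) x
      = deriv (\<lambda>x. a * (deriv ^^ n) f x + b * (deriv ^^ n) g x) x"
    unfolding funpow.simps o_apply
  proof (rule deriv_cong_ev)
    have "(deriv ^^ n) (\<lambda>y. a * f y + b * g y) z = a * (deriv ^^ n) f z + b * (deriv ^^ n) g z"
      if "z \<in> U" for z
      by (rule Suc.IH[OF Suc.prems(1)]) (simp_all add: Suc.prems that)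
    then show "\<forall>\<^sub>F z in nhds x. (deriv ^^ n) (\<lambda>y. a * f y + b * g y) z
        = a * (deriv ^^ n) f z + b * (deriv ^^ n) g z"
      using eventually_nhds_in_open[OF Suc.prems(1,4)] by (rule eventually_mono[rotated])
  qed simp
  also have "\<dots> = a * (deriv ^^ Suc n) f x + b * (deriv ^^ Suc n) g x"
  proof -
    have "((deriv ^^ n) f has_real_derivative (deriv ^^ Suc n) f x) (at x)"
      "((deriv ^^ n) g has_real_derivative (deriv ^^ Suc n) g x) (at x)"
      using Suc.prems by (auto simp: field_differentiable_derivI)
    then show ?thesis
      by (intro DERIV_imp_deriv DERIV_add DERIV_cmult)
  qed
  finally show ?case .
qed simp

text \<open>The induction descends by two orders: the second derivative combines series with
  \<open>p + 2\<close> and exponents \<open>r\<close>, \<open>r + 2\<close>, so order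
  \<open>i + 2\<close> reduces to order \<open>i\<close> for changed \<open>p\<close> and
  \<open>r\<close>. Orders 0 and 1 come from termwise differentiation.\<close>

lemma higher_deriv_S_bar_differentiable:
  assumes "r \<ge> 1" "y > 0"
  shows "(deriv ^^ n) (S_bar p r) field_differentiable at y"
  using assms
proof (induction n arbitrary: p r y rule: less_induct)
  case (less n)
  obtain T where T: "\<And>y. y > 0 \<Longrightarrow> (S_bar p r has_real_derivative T y) (at y)"
    "\<And>y. y > 0 \<Longrightarrow> (T has_real_derivative
      real r ^ 2 * S_bar (p + 2) r y + real (r * (r + 1)) * S_bar (p + 2) (r + 2) y) (at y)"
    using S_bar_deriv2[OF less.prems(1)] by blast
  consider "n = 0" | "n = 1" | i where "n = i + 2"
    by (metis One_nat_def add_2_eq_Suc' not0_implies_Suc)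
  then show ?case
  proof cases
    case 1
    then show ?thesis using T(1) less.prems by (auto simp: field_differentiable_def)
  next
    case 2
    have "(deriv (S_bar p r) has_real_derivative
      real r ^ 2 * S_bar (p + 2) r y + real (r * (r + 1)) * S_bar (p + 2) (r + 2) y) (at y)"
      by (rule has_field_derivative_transform_within_open[where S = "{0<..}", OF T(2)])
         (use less.prems(2) in \<open>auto intro!: DERIV_imp_deriv[symmetric] T(1)\<close>)
    then show ?thesis using 2 by (auto simp: field_differentiable_def)
  next
    case 3
    define F G where "F = S_bar (p + 2) r" and "G = S_bar (p + 2) (r + 2)"
    have IH: "(deriv ^^ j) F field_differentiable at x" "(deriv ^^ j) G field_differentiable at x"
      if "j \<le> i" "x > 0" for j x
      unfolding F_def G_def using less.IH[of j] less.prems that 3 by auto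
    have eq: "(deriv ^^ n) (S_bar p r) x
        = real r ^ 2 * (deriv ^^ i) F x + real (r * (r + 1)) * (deriv ^^ i) G x"
      if "x > 0" for x
    proof -
      have "(deriv ^^ n) (S_bar p r) x = (deriv ^^ i) ((deriv ^^ 2) (S_bar p r)) x"
        using 3 by (simp only: funpow_add o_apply)
      also have "\<dots> = (deriv ^^ i) (\<lambda>y. real r ^ 2 * F y + real (r * (r + 1)) * G y) x"
        using that less.prems(1) unfolding F_def G_def
        by (intro higher_deriv_cong_open[of "{0<..}"]) (auto simp: S_bar_second_deriv)
      also have "\<dots> = real r ^ 2 * (deriv ^^ i) F x + real (r * (r + 1)) * (deriv ^^ i) G x"
        using that IH by (intro higher_deriv_linear_combination[of "{0<..}"]) auto
      finally show ?thesis .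
    qed
    have "((\<lambda>x. real r ^ 2 * (deriv ^^ i) F x + real (r * (r + 1)) * (deriv ^^ i) G x)
        has_real_derivative real r ^ 2 * deriv ((deriv ^^ i) F) y
          + real (r * (r + 1)) * deriv ((deriv ^^ i) G) y) (at y)"
      using IH less.prems by (intro DERIV_add DERIV_cmult field_differentiable_derivI) auto
    then have "((deriv ^^ n) (S_bar p r) has_real_derivative real r ^ 2 * deriv ((deriv ^^ i) F) y
          + real (r * (r + 1)) * deriv ((deriv ^^ i) G) y) (at y)"
      by (rule has_field_derivative_transform_within_open[where S = "{0<..}"])
         (use less.prems(2) in \<open>auto simp: eq\<close>)
    then show ?thesis by (auto simp: field_differentiable_def)
  qed
qed

text \<open>Applied twice, this differentiates the expansion supplied by the induction hypothesis on
  the exponent.\<close>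

lemma deriv_sum_higher_deriv_S_bar:
  assumes "y > 0"
  shows "deriv (\<lambda>y. \<Sum>j\<in>A. c j * (deriv ^^ d j) (S_bar (q j) 1) y) y
    = (\<Sum>j\<in>A. c j * (deriv ^^ Suc (d j)) (S_bar (q j) 1) y)"
proof -
  have "((deriv ^^ d j) (S_bar (q j) 1) has_real_derivative
      (deriv ^^ Suc (d j)) (S_bar (q j) 1) y) (at y)" for j
    using field_differentiable_derivI[OF higher_deriv_S_bar_differentiable[of 1 y "d j" "q j"]] assms by simp
  then show ?thesis
    by (intro DERIV_imp_deriv DERIV_sum DERIV_cmult)
qed

text \<open>The coefficients depend on the exponent \<open>2 k + 1\<close> only, not on the power \<open>p\<close> of \<open>n\<close>: this
  lets the induction hypothesis be used for both \<open>p\<close> and \<open>p - 2\<close> with the same \<open>b\<close>.\<close>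

lemma S_bar_odd_exponent:
  "\<exists>b :: nat \<Rightarrow> rat. \<forall>p y. y > 0 \<longrightarrow> S_bar p (2 * k + 1) y =
    (\<Sum>j = 0..k. of_rat (b j) * (deriv ^^ (2 * j)) (S_bar (p - 2 * int j) 1) y)"
proof (induction k)
  case 0
  show ?case by (rule exI[of _ "\<lambda>_. 1"]) simp
next
  case (Suc k)
  then obtain b :: "nat \<Rightarrow> rat" where b: "\<And>p y. y > 0 \<Longrightarrow> S_bar p (2 * k + 1) y =
      (\<Sum>j = 0..k. of_rat (b j) * (deriv ^^ (2 * j)) (S_bar (p - 2 * int j) 1) y)"
    by blast
  define r where "r = 2 * k + 1"
  \<comment> \<open>The recurrence solved for exponent \<open>r + 2\<close> dictates these values:
    the second derivative moves \<open>b (j - 1)\<close> to place \<open>j\<close>, and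
    \<open>r ^ 2\<close> times the old expansion is subtracted. The zeros at \<open>j = 0\<close>
    and \<open>j = Suc k\<close> pad both sums to a common range.\<close>
  define b' where "b' j = ((if j = 0 then 0 else b (j - 1))
    - of_nat r ^ 2 * (if j = Suc k then 0 else b j)) / of_nat (r * (r + 1))" for j
  have "S_bar p (2 * Suc k + 1) y =
      (\<Sum>j = 0..Suc k. of_rat (b' j) * (deriv ^^ (2 * j)) (S_bar (p - 2 * int j) 1) y)"
    if "y > 0" for p y
  proof -
    \<comment> \<open>Derivative order and power of \<open>n\<close> are tied together, so two
      derivatives of the \<open>j\<close>-th term for \<open>p - 2\<close> give exactly
      \<open>D (Suc j)\<close>.\<close>
    define D where "D j = (deriv ^^ (2 * j)) (S_bar (p - 2 * int j) 1) y" for j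
    have "(deriv ^^ 2) (S_bar (p - 2) r) y = (deriv ^^ 2) (\<lambda>y. \<Sum>j = 0..k.
        of_rat (b j) * (deriv ^^ (2 * j)) (S_bar (p - 2 - 2 * int j) 1) y) y"
      using that by (intro higher_deriv_cong_open[of "{0<..}"]) (auto simp: r_def b[simplified])
    also have "\<dots> = deriv (\<lambda>y. \<Sum>j = 0..k.
        of_rat (b j) * (deriv ^^ (Suc (2 * j))) (S_bar (p - 2 - 2 * int j) 1) y) y"
      unfolding numeral_2_eq_2 funpow.simps o_apply id_apply
      using that deriv_sum_higher_deriv_S_bar
      by (intro deriv_cong_ev eventually_mono[OF eventually_nhds_in_open[of "{0<..}"]]) auto
    also have "\<dots> = (\<Sum>j = 0..k.
        of_rat (b j) * (deriv ^^ (Suc (Suc (2 * j)))) (S_bar (p - 2 - 2 * int j) 1) y)"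
      by (rule deriv_sum_higher_deriv_S_bar[OF that])
    also have "\<dots> = (\<Sum>j = 0..k. of_rat (b j) * D (Suc j))"
      unfolding D_def by (simp add: algebra_simps del: funpow.simps)
    also have "\<dots> = (\<Sum>j = 0..Suc k. of_rat (if j = 0 then 0 else b (j - 1)) * D j)"
      by (simp add: sum.atLeast0_atMost_Suc_shift del: sum.cl_ivl_Suc)
    finally have deriv2: "(deriv ^^ 2) (S_bar (p - 2) r) y
        = (\<Sum>j = 0..Suc k. of_rat (if j = 0 then 0 else b (j - 1)) * D j)" .
    have "S_bar p r y = (\<Sum>j = 0..k. of_rat (b j) * D j)"
      using b[OF that] by (simp add: r_def D_def)
    also have "\<dots> = (\<Sum>j = 0..Suc k. of_rat (if j = Suc k then 0 else b j) * D j)"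
      by simp
    finally have low: "S_bar p r y
        = (\<Sum>j = 0..Suc k. of_rat (if j = Suc k then 0 else b j) * D j)" .
    have "S_bar p (r + 2) y
        = ((deriv ^^ 2) (S_bar (p - 2) r) y - real r ^ 2 * S_bar p r y) / real (r * (r + 1))"
    proof -
      have "real (r * (r + 1)) \<noteq> 0" unfolding of_nat_eq_0_iff by (simp add: r_def)
      then show ?thesis
        using S_bar_second_deriv[of r y "p - 2"] that
        by (simp add: r_def eq_divide_eq mult.commute del: of_nat_mult of_nat_add of_nat_Suc)
    qed
    also have "\<dots> = (\<Sum>j = 0..Suc k. of_rat (b' j) * D j)"
      unfolding deriv2 low b'_def sum_distrib_left sum_subtractf[symmetric] sum_divide_distrib
      by (intro sum.cong refl) (simp only: of_rat_divide of_rat_diff of_rat_mult of_rat_power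
          of_rat_of_nat_eq left_diff_distrib diff_divide_distrib mult.assoc times_divide_eq_left)
    finally show ?thesis
      by (simp add: r_def D_def)
  qed
  then show ?case by blast
qed

theorem theorem4p9:
  fixes m k :: nat
  assumes "m \<ge> 1"
  shows "\<exists>b :: nat \<Rightarrow> rat. \<forall>y::real. y > 0 \<longrightarrow>
    S_bar (2 * (int m + int k) - 1) (2 * k + 1) y =
      (\<Sum>j = 0..k. of_rat (b j) *
        (deriv ^^ (2 * j)) (S_bar (2 * (int m + int k - int j) - 1) 1) y)"
proof -
  \<comment> \<open>For \<open>p = 2 * (int m + int k) - 1\<close>, lowering \<open>p\<close> by
    \<open>2 * j\<close> amounts to replacing \<open>m + k\<close> by
    \<open>m + k - j\<close>.\<close>
  have idx: "2 * (int m + int k - int j) - 1 = 2 * (int m + int k) - 1 - 2 * int j" for j by simp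
  obtain b where "\<forall>p y. y > 0 \<longrightarrow> S_bar p (2 * k + 1) y =
      (\<Sum>j = 0..k. of_rat (b j) * (deriv ^^ (2 * j)) (S_bar (p - 2 * int j) 1) y)"
    using S_bar_odd_exponent[of k] ..
  then show ?thesis
    unfolding idx by (intro exI[of _ b]) blast
qed

end
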